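(* Let $v\in A_1$. There exists a dimensional constant $c$, independent of $[v]_{A_1}$, such that $$\left\|\frac{M(f)}{v}\right\|_{L^{1,\infty}(v)}\le c\,[v]_{A_1}\,\|f\|_{L^1(\mathbb{R}^n)}.$$ Furthermore, the linear dependence on $[v]_{A_1}$ is sharp.
   Context: A weight is a nonnegative locally integrable function on $\mathbb{R}^n$. For a weight $v$, $[v]_{A_1}=\sup_Q\left(\frac1{|Q|}\int_Q v\right)(\operatorname{ess\,inf}_Q v)^{-1}$, the supremum being over all cubes $Q\subset\mathbb{R}^n$, and $v\in A_1$ means $[v]_{A_1}<\infty$. $M$ is the Hardy–Littlewood maximal operator, $Mf(x)=\sup_{Q\ni x}\frac1{|Q|}\int_Q|f|$, the supremum being over all cubes $Q$ containing $x$. $\|F\|_{L^{1,\infty}(v)}=\sup_{t>0} t\, v(\{x:|F(x)|>t\})$, where $v(E)=\int_E v\,dx$. A dimensional constant is one depending only on $n$. *)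

theory Defs
  imports "HOL-Analysis.Analysis"
begin

text \<open>Cubes have sides parallel to the coordinate axes and positive side length; closed cubes are
  used. All averages, suprema and distribution functions below take values in \<^typ>\<open>ennreal\<close>, where
  \<open>inverse 0 = \<infinity>\<close> and \<open>0 * \<infinity> = 0\<close>.\<close>

definition cubes :: "(real^'n) set set" where
  "cubes = {cbox a (\<chi> i. a $ i + l) | a l. 0 < l}"

definition average :: "(real^'n) set \<Rightarrow> (real^'n \<Rightarrow> ennreal) \<Rightarrow> ennreal" where
  "average Q g = (\<integral>\<^sup>+x\<in>Q. g x \<partial>lebesgue) / emeasure lebesgue Q"

definition ess_inf_on :: "(real^'n) set \<Rightarrow> (real^'n \<Rightarrow> ennreal) \<Rightarrow> ennreal" where
  "ess_inf_on Q g = Sup {z. AE x in lebesgue. x \<in> Q \<longrightarrow> z \<le> g x}"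

definition weight :: "(real^'n \<Rightarrow> real) \<Rightarrow> bool" where
  "weight v \<longleftrightarrow> (\<forall>x. 0 \<le> v x) \<and> (\<forall>K. compact K \<longrightarrow> v absolutely_integrable_on K)"

text \<open>If \<open>v\<close> vanishes on a set of positive measure without vanishing almost everywhere, then some cube
  contributes \<open>\<infinity>\<close> and \<open>v\<close> is not in \<open>A\<^sub>1\<close>. The weight \<open>v = 0\<close> has constant \<open>0\<close>.\<close>

definition A1_const :: "(real^'n \<Rightarrow> real) \<Rightarrow> ennreal" where
  "A1_const v = (SUP Q\<in>cubes. average Q (\<lambda>x. ennreal (v x)) * inverse (ess_inf_on Q (\<lambda>x. ennreal (v x))))"

definition A1 :: "(real^'n \<Rightarrow> real) set" where
  "A1 = {v. weight v \<and> A1_const v < \<infinity>}"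

definition maximal :: "(real^'n \<Rightarrow> real) \<Rightarrow> real^'n \<Rightarrow> ennreal" where
  "maximal f x = (SUP Q\<in>{Q \<in> cubes. x \<in> Q}. average Q (\<lambda>y. ennreal \<bar>f y\<bar>))"

text \<open>The functions \<open>F\<close> of interest are nonnegative and possibly infinite, so no absolute value
  appears.\<close>

definition weak_L1_norm :: "(real^'n \<Rightarrow> real) \<Rightarrow> (real^'n \<Rightarrow> ennreal) \<Rightarrow> ennreal" where
  "weak_L1_norm v F = (SUP t\<in>{0<..}. ennreal t * (\<integral>\<^sup>+x\<in>{x. ennreal t < F x}. ennreal (v x) \<partial>lebesgue))"

definition L1_norm :: "(real^'n \<Rightarrow> real) \<Rightarrow> ennreal" where
  "L1_norm f = (\<integral>\<^sup>+x. ennreal \<bar>f x\<bar> \<partial>lebesgue)"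

text \<open>On the set where \<open>v\<close> vanishes the quotient \<open>M f / v\<close> is irrelevant: that set is null for the
  measure \<open>v dx\<close>.\<close>

end

theory Submission
  imports Defs
begin

text \<open>
  Upper bound. If \<open>M f x > t v x\<close>, some cube \<open>Q\<close> containing \<open>x\<close> satisfies \<open>t v(x) |Q| < \<integral>\<^bsub>Q\<^esub> |f|\<close>.
  Comparing \<open>v(5B)\<close>, for a ball \<open>B\<close> containing \<open>Q\<close> and of comparable size, with the point value
  \<open>v x\<close> rather than with \<open>v(B)\<close> uses the \<open>A\<^sub>1\<close> condition only once:
  \<open>t v(5B) \<le> c [v] t |Q| v(x) \<le> c [v] \<integral>\<^bsub>Q\<^esub> |f|\<close>, and the Vitali covering lemma finishes the proof.

  Sharpness. With \<open>C\<^sub>k = [-2\<^sup>-\<^sup>k, 2\<^sup>-\<^sup>k]\<^sup>n\<close>, take \<open>v = 1 + \<Sum>k\<le>N. 2\<^sup>n\<^sup>k 1\<^bsub>C\<^sub>k\<^esub>\<close> and \<open>f\<close> the indicator of \<open>C\<^sub>N\<close>.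
  On \<open>C\<^sub>0\<close> the functions \<open>M f\<close> and \<open>2\<^sup>-\<^sup>n\<^sup>N v\<close> are comparable, while \<open>v(C\<^sub>0)\<close> and \<open>[v]\<close> are both of
  order \<open>N\<close>. That \<open>[v]\<close> is unbounded in \<open>N\<close> follows from the upper bound itself.
\<close>

section \<open>Cubes, averages and measurability of weights\<close>

lemma cubesE:
  assumes "Q \<in> cubes"
  obtains a l where "0 < l" "Q = cbox a (\<chi> i. a $ i + l)"
  using assms by (auto simp: cubes_def)

lemma mem_cube:
  fixes a :: "real^'n"
  shows "x \<in> cbox a (\<chi> i. a $ i + l) \<longleftrightarrow> (\<forall>i. a $ i \<le> x $ i \<and> x $ i \<le> a $ i + l)"
  by (simp add: mem_box_cart)

lemma emeasure_cube:
  fixes a :: "real^'n"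
  assumes "0 \<le> l"
  shows "emeasure lebesgue (cbox a (\<chi> i. a $ i + l)) = ennreal (l ^ CARD('n))"
proof -
  have "a \<in> cbox a (\<chi> i. a $ i + l)"
    using assms by (simp add: mem_cube)
  then have "measure lebesgue (cbox a (\<chi> i. a $ i + l)) = l ^ CARD('n)"
    by (subst measure_completion) (auto simp: content_cbox_if_cart)
  moreover have "emeasure lebesgue (cbox a (\<chi> i. a $ i + l)) =
      ennreal (measure lebesgue (cbox a (\<chi> i. a $ i + l)))"
    using emeasure_lborel_cbox_finite[of a "\<chi> i. a $ i + l"]
    by (intro emeasure_eq_ennreal_measure) (simp add: less_top)
  ultimately show ?thesis by simp
qed

lemma emeasure_cubes:
  assumes "Q \<in> cubes"
  shows "0 < emeasure lebesgue Q" "emeasure lebesgue Q < \<infinity>"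
  using assms by (auto elim!: cubesE simp: emeasure_cube simp del: emeasure_completion)

lemma sets_cubes: "Q \<in> cubes \<Longrightarrow> Q \<in> sets lebesgue"
  by (auto elim!: cubesE)

lemma average_mult_emeasure:
  assumes "Q \<in> cubes"
  shows "average Q g * emeasure lebesgue Q = (\<integral>\<^sup>+x\<in>Q. g x \<partial>lebesgue)"
  unfolding average_def ennreal_divide_times
  using emeasure_cubes[OF assms] by (subst ennreal_divide_self) auto

text \<open>Local integrability gives measurability on each ball about the origin; these truncations
  are eventually constant at every point.\<close>

lemma measurable_weight:
  fixes v :: "real^'n \<Rightarrow> real"
  assumes "weight v"
  shows "v \<in> borel_measurable lebesgue"
proof (rule borel_measurable_LIMSEQ_real)
  fix k :: nat
  have "v absolutely_integrable_on cball 0 (real k)"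
    using assms by (auto simp: weight_def)
  then show "(\<lambda>x. indicator (cball 0 (real k)) x *\<^sub>R v x) \<in> borel_measurable lebesgue"
    unfolding set_integrable_def by (rule borel_measurable_integrable)
next
  fix x :: "real^'n"
  show "(\<lambda>k. indicator (cball 0 (real k)) x *\<^sub>R v x) \<longlonglongrightarrow> v x"
  proof (rule tendsto_eventually)
    show "\<forall>\<^sub>F k in sequentially. indicator (cball 0 (real k)) x *\<^sub>R v x = v x"
      using eventually_ge_at_top[of "nat \<lceil>norm x\<rceil>"]
      by eventually_elim (auto simp: indicator_def nat_ceiling_le_eq)
  qed
qed

section \<open>Essential infimum and the \<open>A1\<close> condition at points\<close>

text \<open>Uncountably many lower bounds \<open>z\<close> would bring uncountably many null sets.
  The supremum is already reached along a sequence, so countably many suffice.\<close>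

lemma ess_inf_on_AE: "AE x in lebesgue. x \<in> Q \<longrightarrow> ess_inf_on Q g \<le> g x"
proof -
  define S where "S = {z. AE x in lebesgue. x \<in> Q \<longrightarrow> z \<le> g x}"
  have "0 \<in> S" by (simp add: S_def)
  then have "S \<noteq> {}" by blast
  from ennreal_Sup_countable_SUP[OF this]
  obtain f :: "nat \<Rightarrow> ennreal" where f: "range f \<subseteq> S" "Sup S = (SUP i. f i)"
    by blast
  have "f i \<in> S" for i
    using f(1) by blast
  then have "AE x in lebesgue. \<forall>i. x \<in> Q \<longrightarrow> f i \<le> g x"
    unfolding AE_all_countable by (simp add: S_def)
  then show ?thesis
    unfolding ess_inf_on_def S_def[symmetric] f(2)
    by eventually_elim (auto intro!: SUP_least)
qed

text \<open>The defining quotient of \<open>A1_const\<close> is cleared of its inverse, and the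
  essential infimum is replaced by the value at almost every point. The exceptional null set still
  depends on \<open>Q\<close>.\<close>

lemma A1_nn_integral_le:
  fixes v :: "real^'n \<Rightarrow> real"
  assumes "v \<in> A1" and Q: "Q \<in> cubes"
  shows "AE x in lebesgue. x \<in> Q \<longrightarrow>
    (\<integral>\<^sup>+y\<in>Q. ennreal (v y) \<partial>lebesgue) \<le> A1_const v * emeasure lebesgue Q * ennreal (v x)"
  using ess_inf_on_AE[of Q "\<lambda>x. ennreal (v x)"]
proof eventually_elim
  case (elim x)
  let ?m = "average Q (\<lambda>x. ennreal (v x))" and ?e = "ess_inf_on Q (\<lambda>x. ennreal (v x))"
  show ?case
  proof
    assume "x \<in> Q"
    then have e: "?e \<le> ennreal (v x)" using elim by simp
    have fin: "?e \<noteq> top" using e by (auto simp: top_unique)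
    have le: "?m * inverse ?e \<le> A1_const v"
      unfolding A1_const_def using Q by (intro SUP_upper)
    have C: "A1_const v < top" using assms by (auto simp: A1_def)
    have "?m \<le> A1_const v * ?e"
    proof (cases "?e = 0")
      case True
      \<comment> \<open>Here \<open>inverse ?e\<close> is infinite, so a finite product with
        \<open>?m\<close> forces \<open>?m = 0\<close>.\<close>
      with le C have "?m = 0" by (auto simp: ennreal_mult_top top_unique split: if_splits)
      then show ?thesis by simp
    next
      case False
      have "?m = ?m * inverse ?e * ?e"
        using False fin by (metis divide_ennreal_def ennreal_divide_times ennreal_divide_self mult.right_neutral less_top)
      also have "\<dots> \<le> A1_const v * ?e" using le by (rule mult_right_mono) simp
      finally show ?thesis .
    qed
    also have "\<dots> \<le> A1_const v * ennreal (v x)" using e by (rule mult_left_mono) simp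
    finally have "?m * emeasure lebesgue Q \<le> A1_const v * ennreal (v x) * emeasure lebesgue Q"
      by (rule mult_right_mono) simp
    then show "(\<integral>\<^sup>+y\<in>Q. ennreal (v y) \<partial>lebesgue) \<le> A1_const v * emeasure lebesgue Q * ennreal (v x)"
      unfolding average_mult_emeasure[OF Q] by (simp only: mult_ac)
  qed
qed

text \<open>Cubes with corners in a countable dense set and rational side lengths approximate all
  balls, which lets one null set serve every ball.\<close>

lemma countable_cubes_around_cballs:
  obtains D :: "(real^'n) set set" where "countable D" "D \<subseteq> cubes"
    "\<And>c \<rho>. 0 < \<rho> \<Longrightarrow> \<exists>Q\<in>D. cball c \<rho> \<subseteq> Q \<and> emeasure lebesgue Q \<le> ennreal ((5 * \<rho>) ^ CARD('n))"
proof -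
  obtain A :: "(real^'n) set" where A: "countable A" "\<And>X. open X \<Longrightarrow> X \<noteq> {} \<Longrightarrow> \<exists>d\<in>A. d \<in> X"
    using countable_dense_setE by blast
  define D where "D = (\<lambda>(a, l). cbox a (\<chi> i. a $ i + l)) ` (A \<times> (\<rat> \<inter> {0<..}))"
  show ?thesis
  proof
    show "countable D"
      unfolding D_def using A(1) countable_rat by (intro countable_image countable_SIGMA) auto
    show "D \<subseteq> cubes" by (auto simp: D_def cubes_def)
    fix c :: "real^'n" and \<rho> :: real
    assume \<rho>: "0 < \<rho>"
    \<comment> \<open>A corner within \<open>\<rho>\<close> of \<open>c - 2\<rho>\<close> has each
      coordinate between \<open>c - 3\<rho>\<close> and \<open>c - \<rho>\<close>. A side longer
      than \<open>4\<rho>\<close> then passes \<open>c + \<rho>\<close>, and a side below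
      \<open>5\<rho>\<close> controls the volume.\<close>
    let ?b = "(\<chi> i. c $ i - 2 * \<rho>) :: real^'n"
    obtain a where a: "a \<in> A" "a \<in> ball ?b \<rho>"
      using A(2)[of "ball ?b \<rho>"] \<rho> by auto
    have ai: "\<bar>c $ i - 2 * \<rho> - a $ i\<bar> < \<rho>" for i
      using component_le_norm_cart[of "?b - a" i] a(2) by (simp add: dist_norm)
    obtain l where l: "l \<in> \<rat>" "4 * \<rho> < l" "l < 5 * \<rho>"
      using Rats_dense_in_real[of "4 * \<rho>" "5 * \<rho>"] \<rho> by auto
    show "\<exists>Q\<in>D. cball c \<rho> \<subseteq> Q \<and> emeasure lebesgue Q \<le> ennreal ((5 * \<rho>) ^ CARD('n))"
    proof (intro bexI conjI)
      show "cbox a (\<chi> i. a $ i + l) \<in> D"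
        using a l \<rho> by (auto simp: D_def)
      show "cball c \<rho> \<subseteq> cbox a (\<chi> i. a $ i + l)"
      proof
        fix y assume y: "y \<in> cball c \<rho>"
        have yi: "\<bar>c $ i - y $ i\<bar> \<le> \<rho>" for i
          using component_le_norm_cart[of "c - y" i] y by (simp add: dist_norm)
        have "a $ i \<le> y $ i \<and> y $ i \<le> a $ i + l" for i
          using ai[of i] yi[of i] l(2) by linarith
        then show "y \<in> cbox a (\<chi> i. a $ i + l)" by (simp add: mem_cube)
      qed
      show "emeasure lebesgue (cbox a (\<chi> i. a $ i + l)) \<le> ennreal ((5 * \<rho>) ^ CARD('n))"
        using l \<rho> by (subst emeasure_cube) (simp, intro ennreal_leI power_mono, simp_all)
    qed
  qed
qed

text \<open>Each ball is enlarged to a cube of the countable family, and the countably many null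
  sets are united. The quantifier over balls stands inside \<open>AE\<close> because the balls used
  later depend on the point.\<close>

lemma A1_nn_integral_cball_le:
  fixes v :: "real^'n \<Rightarrow> real"
  assumes "v \<in> A1"
  shows "AE x in lebesgue. \<forall>c \<rho>. 0 < \<rho> \<longrightarrow> x \<in> cball c \<rho> \<longrightarrow>
    (\<integral>\<^sup>+y\<in>cball c \<rho>. ennreal (v y) \<partial>lebesgue)
      \<le> A1_const v * ennreal ((5 * \<rho>) ^ CARD('n)) * ennreal (v x)"
proof -
  obtain D :: "(real^'n) set set" where D: "countable D" "D \<subseteq> cubes"
    "\<And>c \<rho>. 0 < \<rho> \<Longrightarrow> \<exists>Q\<in>D. cball c \<rho> \<subseteq> Q \<and> emeasure lebesgue Q \<le> ennreal ((5 * \<rho>) ^ CARD('n))"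
    using countable_cubes_around_cballs by metis
  have "AE x in lebesgue. \<forall>Q\<in>D. x \<in> Q \<longrightarrow>
    (\<integral>\<^sup>+y\<in>Q. ennreal (v y) \<partial>lebesgue) \<le> A1_const v * emeasure lebesgue Q * ennreal (v x)"
    using D(2) A1_nn_integral_le[OF assms] by (subst AE_ball_countable[OF D(1)]) auto
  then show ?thesis
  proof (eventually_elim, intro allI impI)
    fix x c \<rho>
    assume *: "\<forall>Q\<in>D. x \<in> Q \<longrightarrow>
        (\<integral>\<^sup>+y\<in>Q. ennreal (v y) \<partial>lebesgue) \<le> A1_const v * emeasure lebesgue Q * ennreal (v x)"
      and \<rho>: "0 < (\<rho>::real)" and x: "x \<in> cball c \<rho>"
    obtain Q where Q: "Q \<in> D" "cball c \<rho> \<subseteq> Q" "emeasure lebesgue Q \<le> ennreal ((5 * \<rho>) ^ CARD('n))"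
      using D(3)[OF \<rho>] by blast
    have "(\<integral>\<^sup>+y\<in>cball c \<rho>. ennreal (v y) \<partial>lebesgue) \<le> (\<integral>\<^sup>+y\<in>Q. ennreal (v y) \<partial>lebesgue)"
      using Q(2) by (intro nn_integral_mono mult_left_mono) (auto simp: indicator_def)
    also have "\<dots> \<le> A1_const v * emeasure lebesgue Q * ennreal (v x)"
      using * Q x by auto
    also have "\<dots> \<le> A1_const v * ennreal ((5 * \<rho>) ^ CARD('n)) * ennreal (v x)"
      using Q(3) by (intro mult_right_mono mult_left_mono) auto
    finally show "(\<integral>\<^sup>+y\<in>cball c \<rho>. ennreal (v y) \<partial>lebesgue)
      \<le> A1_const v * ennreal ((5 * \<rho>) ^ CARD('n)) * ennreal (v x)" .
  qed
qed

section \<open>Cube selection, covering and the weak-type bound\<close>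

text \<open>For nonmeasurable \<open>g\<close> the monotone convergence theorem is unavailable. It is applied to the simple
  functions below \<open>g\<close> instead.\<close>

lemma nn_integral_le_exhaustion:
  fixes g :: "'a \<Rightarrow> ennreal" and A :: "nat \<Rightarrow> 'a set"
  assumes "incseq A" and [measurable]: "\<And>k. A k \<in> sets M"
    and supp: "{x. g x \<noteq> 0} \<subseteq> (\<Union>k. A k)"
    and le: "\<And>k. (\<integral>\<^sup>+x\<in>A k. g x \<partial>M) \<le> B"
  shows "(\<integral>\<^sup>+x. g x \<partial>M) \<le> B"
  unfolding nn_integral_def
proof (rule SUP_least, safe)
  fix s assume s[measurable]: "simple_function M s" and sg: "s \<le> g"
  have inc: "incseq (\<lambda>k x. s x * indicator (A k) x)"
    using incseqD[OF assms(1)] by (auto simp: incseq_def le_fun_def indicator_def)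
  have "(SUP k. s x * indicator (A k) x) = s x" for x
  proof (cases "s x = 0")
    case False
    with sg have "g x \<noteq> 0" by (metis le_fun_def le_zero_eq)
    then obtain k where k: "x \<in> A k" using supp by auto
    show ?thesis
    proof (rule antisym)
      show "(SUP k. s x * indicator (A k) x) \<le> s x"
        by (rule SUP_least) (auto simp: indicator_def)
      show "s x \<le> (SUP k. s x * indicator (A k) x)"
        using k by (intro SUP_upper2[of k]) auto
    qed
  qed simp
  then have "integral\<^sup>S M s = (\<integral>\<^sup>+x. (SUP k. s x * indicator (A k) x) \<partial>M)"
    by (simp add: nn_integral_eq_simple_integral[OF s])
  also have "\<dots> = (SUP k. \<integral>\<^sup>+x\<in>A k. s x \<partial>M)"
    using borel_measurable_simple_function[OF s]
    by (intro nn_integral_monotone_convergence_SUP inc) auto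
  also have "\<dots> \<le> B"
  proof (rule SUP_least)
    fix k
    have "(\<integral>\<^sup>+x\<in>A k. s x \<partial>M) \<le> (\<integral>\<^sup>+x\<in>A k. g x \<partial>M)"
      using sg by (intro nn_integral_mono mult_right_mono) (auto simp: le_fun_def)
    also note le[of k]
    finally show "(\<integral>\<^sup>+x\<in>A k. s x \<partial>M) \<le> B" .
  qed
  finally show "integral\<^sup>S M s \<le> B" .
qed

text \<open>The Euclidean norm is at most the sum of the coordinates. The factor \<open>n\<close>
  lost here is dimensional.\<close>

lemma cube_subset_cball:
  fixes a :: "real^'n"
  shows "cbox a (\<chi> i. a $ i + l) \<subseteq> cball a (real CARD('n) * l)"
proof
  fix y assume "y \<in> cbox a (\<chi> i. a $ i + l)"
  then have "a $ i \<le> y $ i \<and> y $ i \<le> a $ i + l" for i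
    by (simp add: mem_cube)
  then have "\<bar>(a - y) $ i\<bar> \<le> l" for i
    by (smt (verit) vector_minus_component)
  then have "(\<Sum>i\<in>UNIV. \<bar>(a - y) $ i\<bar>) \<le> real CARD('n) * l"
    using sum_bounded_above[of "UNIV :: 'n set" "\<lambda>i. \<bar>(a - y) $ i\<bar>" l] by simp
  then show "y \<in> cball a (real CARD('n) * l)"
    using norm_le_l1_cart[of "a - y"] by (simp add: dist_norm)
qed

lemma maximal_gt_cubeE:
  assumes "s < maximal f x"
  obtains a l where "0 < l" "x \<in> cbox a (\<chi> i. a $ i + l)"
    "s * ennreal (l ^ CARD('n)) \<le> (\<integral>\<^sup>+y\<in>cbox a (\<chi> i. a $ i + l). ennreal \<bar>f (y :: real^'n)\<bar> \<partial>lebesgue)"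
proof -
  obtain Q where Q: "Q \<in> cubes" "x \<in> Q" "s < average Q (\<lambda>y. ennreal \<bar>f y\<bar>)"
    using assms unfolding maximal_def less_SUP_iff by auto
  then have "s * emeasure lebesgue Q \<le> average Q (\<lambda>y. ennreal \<bar>f y\<bar>) * emeasure lebesgue Q"
    by (intro mult_right_mono) auto
  also note average_mult_emeasure[OF Q(1)]
  finally show ?thesis
    using Q that by (auto elim!: cubesE simp: emeasure_cube simp del: emeasure_completion)
qed

text \<open>Countable additivity of the measure with density \<open>g\<close>.\<close>

lemma nn_integral_disjoint_le:
  assumes [measurable]: "g \<in> borel_measurable M" and "countable I"
    and [measurable]: "\<And>i. i \<in> I \<Longrightarrow> X i \<in> sets M" and "disjoint_family_on X I"
  shows "(\<integral>\<^sup>+i. (\<integral>\<^sup>+x\<in>X i. g x \<partial>M) \<partial>count_space I) \<le> (\<integral>\<^sup>+x. g x \<partial>M)"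
proof -
  have "(\<integral>\<^sup>+i. (\<integral>\<^sup>+x\<in>X i. g x \<partial>M) \<partial>count_space I)
    = (\<integral>\<^sup>+i. emeasure (density M g) (X i) \<partial>count_space I)"
    by (intro nn_integral_cong) (simp add: emeasure_density)
  also have "\<dots> = emeasure (density M g) (\<Union>i\<in>I. X i)"
    using assms by (intro emeasure_UN_countable[symmetric]) auto
  also have "\<dots> \<le> emeasure (density M g) (space M)"
    using emeasure_space[of "density M g"] by simp
  also have "\<dots> = (\<integral>\<^sup>+x. g x \<partial>M)"
    by (subst emeasure_density) (auto intro!: nn_integral_cong)
  finally show ?thesis .
qed

text \<open>Almost everywhere the indicator of \<open>S\<close> is at most the sum of those of the
  \<open>X i\<close>; sum and integral are then exchanged over the countable index set.\<close>

lemma nn_integral_cover_le: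
  fixes g :: "'a \<Rightarrow> ennreal"
  assumes [measurable]: "g \<in> borel_measurable M" and "countable I"
    and [measurable]: "\<And>i. i \<in> I \<Longrightarrow> X i \<in> sets M"
    and cover: "AE x in M. x \<in> S \<longrightarrow> x \<in> (\<Union>i\<in>I. X i)"
  shows "(\<integral>\<^sup>+x\<in>S. g x \<partial>M) \<le> (\<integral>\<^sup>+i. (\<integral>\<^sup>+x\<in>X i. g x \<partial>M) \<partial>count_space I)"
proof -
  have "(\<integral>\<^sup>+x\<in>S. g x \<partial>M) \<le> (\<integral>\<^sup>+x. (\<integral>\<^sup>+i. g x * indicator (X i) x \<partial>count_space I) \<partial>M)"
    using cover
  proof (intro nn_integral_mono_AE, eventually_elim)
    case (elim x)
    show ?case
    proof (cases "x \<in> S")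
      case True
      then obtain i where "i \<in> I" "x \<in> X i" using elim by auto
      then show ?thesis
        using nn_integral_ge_point[of i I "\<lambda>i. g x * indicator (X i) x"] True by simp
    qed simp
  qed
  also have "\<dots> = (\<integral>\<^sup>+i. (\<integral>\<^sup>+x\<in>X i. g x \<partial>M) \<partial>count_space I)"
    using assms by (intro nn_integral_count_space_nn_integral) auto
  finally show ?thesis .
qed

text \<open>The restriction \<open>\<delta> \<le> v x\<close> bounds the size of the selected cubes,
  as the Vitali lemma requires. The final constant is free of \<open>\<delta>\<close>, so the
  restriction can be lifted afterwards.\<close>

lemma weak_type_truncated:
  fixes v f :: "real^'n \<Rightarrow> real"
  assumes v: "v \<in> A1" and f: "integrable lebesgue f" and t: "0 < t" and \<delta>: "0 < \<delta>"
  defines "S \<equiv> {x. \<delta> \<le> v x \<and> ennreal (t * v x) < maximal f x}"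
  shows "ennreal t * (\<integral>\<^sup>+x\<in>S. ennreal (v x) \<partial>lebesgue)
    \<le> ennreal ((25 * real CARD('n)) ^ CARD('n)) * A1_const v * L1_norm f"
proof -
  let ?n = "CARD('n)"
  let ?C = "ennreal ((25 * real ?n) ^ ?n) * A1_const v"
  have w: "weight v" using v by (simp add: A1_def)
  have mv[measurable]: "v \<in> borel_measurable lebesgue" using w by (rule measurable_weight)
  have mf[measurable]: "f \<in> borel_measurable lebesgue" using f by auto
  have fin: "L1_norm f < \<infinity>"
    using f unfolding L1_norm_def by (simp add: integrable_iff_bounded)
  define B where "B = enn2real (L1_norm f)"
  have B: "0 \<le> B" "L1_norm f = ennreal B" using fin by (auto simp: B_def)
  \<comment> \<open>A set of full measure on which the \<open>A1\<close> estimate holds for all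
    balls at once; only its points are used to select balls.\<close>
  define G where "G = {x. \<forall>c \<rho>. 0 < \<rho> \<longrightarrow> x \<in> cball c \<rho> \<longrightarrow>
    (\<integral>\<^sup>+y\<in>cball c \<rho>. ennreal (v y) \<partial>lebesgue)
      \<le> A1_const v * ennreal ((5 * \<rho>) ^ ?n) * ennreal (v x)}"
  have G: "AE x in lebesgue. x \<in> G"
    using A1_nn_integral_cball_le[OF v] by (simp add: G_def)
  define P where "P x a l \<longleftrightarrow> 0 < l \<and> x \<in> cbox a (\<chi> i. a $ i + l) \<and>
    ennreal (t * v x) * ennreal (l ^ ?n)
      \<le> (\<integral>\<^sup>+y\<in>cbox a (\<chi> i. a $ i + l). ennreal \<bar>f y\<bar> \<partial>lebesgue)" for x a and l :: real
  have "\<exists>a l. P x a l" if "x \<in> S" for x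
  proof -
    have "ennreal (t * v x) < maximal f x" using that by (simp add: S_def)
    then show ?thesis unfolding P_def by (rule maximal_gt_cubeE) blast
  qed
  then obtain a l where "\<And>x. x \<in> S \<Longrightarrow> P x (a x) (l x)"
    by metis
  then have l: "\<And>x. x \<in> S \<Longrightarrow> 0 < l x"
    and al: "\<And>x. x \<in> S \<Longrightarrow> x \<in> cbox (a x) (\<chi> i. a x $ i + l x)"
    and le: "\<And>x. x \<in> S \<Longrightarrow> ennreal (t * v x) * ennreal (l x ^ ?n)
      \<le> (\<integral>\<^sup>+y\<in>cbox (a x) (\<chi> i. a x $ i + l x). ennreal \<bar>f y\<bar> \<partial>lebesgue)"
    unfolding P_def by blast+
  define Q where "Q x = cbox (a x) (\<chi> i. a x $ i + l x)" for x
  define r where "r x = real ?n * l x" for x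
  have r: "0 < r x" if "x \<in> S" for x using l[OF that] by (simp add: r_def)
  have Qr: "Q x \<subseteq> cball (a x) (r x)" for x
    unfolding Q_def r_def by (rule cube_subset_cball)
  \<comment> \<open>If \<open>l x > 1\<close>, then \<open>l x\<close> is at most its
    \<open>n\<close>-th power, and \<open>t * \<delta> * l x\<close> is at most the integral of
    \<open>|f|\<close> over the cube, hence at most \<open>B\<close>.\<close>
  have bound: "l x \<le> max 1 (B / (t * \<delta>))" if x: "x \<in> S" for x
  proof (rule ccontr)
    assume "\<not> ?thesis"
    then have "1 < l x" "B / (t * \<delta>) < l x" by auto
    then have lx: "1 < l x" "B < t * \<delta> * l x" using t \<delta> by (auto simp: pos_divide_less_eq mult_ac)
    have "ennreal (t * v x * l x ^ ?n) \<le> (\<integral>\<^sup>+y\<in>Q x. ennreal \<bar>f y\<bar> \<partial>lebesgue)"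
      using le[OF x] l[OF x] x t \<delta> by (simp add: Q_def S_def ennreal_mult)
    also have "\<dots> \<le> L1_norm f"
      unfolding L1_norm_def by (intro nn_integral_mono) (auto simp: indicator_def)
    finally have "t * v x * l x ^ ?n \<le> B" using B by simp
    moreover have "t * \<delta> * l x \<le> t * v x * l x ^ ?n"
      using x t \<delta> lx(1) by (intro mult_mono self_le_power) (auto simp: S_def)
    ultimately show False using lx(2) by simp
  qed
  have cov: "S \<inter> G \<subseteq> (\<Union>i\<in>S \<inter> G. cball (a i) (r i))"
  proof
    fix x assume x: "x \<in> S \<inter> G"
    then have "x \<in> Q x" using al by (simp add: Q_def)
    then show "x \<in> (\<Union>i\<in>S \<inter> G. cball (a i) (r i))"
      using x Qr[of x] by blast
  qed
  have rbound: "0 < r i \<and> r i \<le> real ?n * max 1 (B / (t * \<delta>))" if "i \<in> S \<inter> G" for i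
  proof
    show "0 < r i" using r that by simp
    show "r i \<le> real ?n * max 1 (B / (t * \<delta>))"
      using bound that unfolding r_def by (intro mult_left_mono) auto
  qed
  \<comment> \<open>The balls are indexed by points of \<open>S \<inter> G\<close> but centred at
    the corners \<open>a i\<close>; the index \<open>i\<close> stays available as the point where
    \<open>v\<close> is evaluated.\<close>
  obtain C where C: "countable C" "C \<subseteq> S \<inter> G"
    "pairwise (\<lambda>i j. disjnt (cball (a i) (r i)) (cball (a j) (r j))) C"
    "S \<inter> G \<subseteq> (\<Union>i\<in>C. cball (a i) (5 * r i))"
    by (rule Vitali_covering_lemma_cballs[OF cov rbound])
  have disj: "disjoint_family_on Q C"
    unfolding disjoint_family_on_def
  proof (intro ballI impI)
    fix i j assume "i \<in> C" "j \<in> C" "i \<noteq> j"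
    then have "disjnt (cball (a i) (r i)) (cball (a j) (r j))"
      using C(3) by (simp add: pairwise_def)
    then show "Q i \<inter> Q j = {}"
      using Qr[of i] Qr[of j] unfolding disjnt_def by blast
  qed
  have "ennreal t * (\<integral>\<^sup>+x\<in>S. ennreal (v x) \<partial>lebesgue)
      \<le> ennreal t * (\<integral>\<^sup>+i. (\<integral>\<^sup>+x\<in>cball (a i) (5 * r i). ennreal (v x) \<partial>lebesgue) \<partial>count_space C)"
  proof (intro mult_left_mono nn_integral_cover_le)
    show "AE x in lebesgue. x \<in> S \<longrightarrow> x \<in> (\<Union>i\<in>C. cball (a i) (5 * r i))"
      using G by eventually_elim (use C(4) in blast)
  qed (use C(1) in auto)
  also have "\<dots> = (\<integral>\<^sup>+i. ennreal t * (\<integral>\<^sup>+x\<in>cball (a i) (5 * r i). ennreal (v x) \<partial>lebesgue) \<partial>count_space C)"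
    by (rule nn_integral_cmult[symmetric]) simp
  also have "\<dots> \<le> (\<integral>\<^sup>+i. ?C * (\<integral>\<^sup>+x\<in>Q i. ennreal \<bar>f x\<bar> \<partial>lebesgue) \<partial>count_space C)"
  proof (rule nn_integral_mono)
    fix i assume "i \<in> space (count_space C)"
    then have i: "i \<in> S" "i \<in> G" using C(2) by auto
    have li: "0 < l i" using l i by blast
    have ir: "0 < 5 * r i" "i \<in> cball (a i) (5 * r i)"
    proof -
      show "0 < 5 * r i" using r[OF i(1)] by simp
      have "i \<in> cball (a i) (r i)" using al[OF i(1)] Qr[of i] unfolding Q_def by blast
      then show "i \<in> cball (a i) (5 * r i)" using r[OF i(1)] by simp
    qed
    have "(\<integral>\<^sup>+x\<in>cball (a i) (5 * r i). ennreal (v x) \<partial>lebesgue)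
        \<le> A1_const v * ennreal ((5 * (5 * r i)) ^ ?n) * ennreal (v i)"
      by (rule i(2)[unfolded G_def mem_Collect_eq, rule_format, OF ir])
    then have "ennreal t * (\<integral>\<^sup>+x\<in>cball (a i) (5 * r i). ennreal (v x) \<partial>lebesgue)
        \<le> ennreal t * (A1_const v * ennreal ((5 * (5 * r i)) ^ ?n) * ennreal (v i))"
      by (rule mult_left_mono) simp
    \<comment> \<open>One factor 5 is the Vitali enlargement, the other the passage from balls to
      cubes; \<open>n\<close> comes from the radius \<open>r i = n * l i\<close>.\<close>
    also have "(5 * (5 * r i)) ^ ?n = (25 * real ?n) ^ ?n * l i ^ ?n"
    proof -
      have "5 * (5 * r i) = 25 * real ?n * l i" by (simp add: r_def)
      then show ?thesis by (simp only: power_mult_distrib)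
    qed
    also have "ennreal ((25 * real ?n) ^ ?n * l i ^ ?n) = ennreal ((25 * real ?n) ^ ?n) * ennreal (l i ^ ?n)"
      using li by (intro ennreal_mult) auto
    also have "ennreal t * (A1_const v * (ennreal ((25 * real ?n) ^ ?n) * ennreal (l i ^ ?n)) * ennreal (v i))
        = ?C * (ennreal (t * v i) * ennreal (l i ^ ?n))"
      using t by (simp only: ennreal_mult'[of t "v i"] less_imp_le mult_ac)
    also have "\<dots> \<le> ?C * (\<integral>\<^sup>+x\<in>Q i. ennreal \<bar>f x\<bar> \<partial>lebesgue)"
      using le[OF i(1)] by (intro mult_left_mono) (auto simp: Q_def)
    finally show "ennreal t * (\<integral>\<^sup>+x\<in>cball (a i) (5 * r i). ennreal (v x) \<partial>lebesgue)
        \<le> ?C * (\<integral>\<^sup>+x\<in>Q i. ennreal \<bar>f x\<bar> \<partial>lebesgue)" .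
  qed
  also have "\<dots> = ?C * (\<integral>\<^sup>+i. (\<integral>\<^sup>+x\<in>Q i. ennreal \<bar>f x\<bar> \<partial>lebesgue) \<partial>count_space C)"
    by (rule nn_integral_cmult) simp
  also have "\<dots> \<le> ?C * L1_norm f"
  proof -
    have "Q i \<in> sets lebesgue" for i by (simp add: Q_def)
    then show ?thesis
      unfolding L1_norm_def using C(1) disj
      by (intro mult_left_mono nn_integral_disjoint_le) auto
  qed
  finally show ?thesis .
qed

text \<open>The truncated estimate is applied on the increasing sets where \<open>v\<close> is at
  least \<open>1/(k+1)\<close>. They exhaust the set where \<open>v\<close> is positive, which
  carries the whole integral.\<close>

lemma weak_type_A1:
  fixes v f :: "real^'n \<Rightarrow> real"
  assumes v: "v \<in> A1" and f: "integrable lebesgue f"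
  shows "weak_L1_norm v (\<lambda>x. maximal f x / ennreal (v x))
    \<le> ennreal ((25 * real CARD('n)) ^ CARD('n)) * A1_const v * L1_norm f"
  unfolding weak_L1_norm_def
proof (rule SUP_least)
  fix t :: real assume "t \<in> {0<..}"
  then have t: "0 < t" by simp
  have w: "weight v" using v by (simp add: A1_def)
  have mv[measurable]: "v \<in> borel_measurable lebesgue" using w by (rule measurable_weight)
  let ?E = "{x. ennreal t < maximal f x / ennreal (v x)}"
  let ?B = "ennreal ((25 * real CARD('n)) ^ CARD('n)) * A1_const v * L1_norm f"
  let ?A = "\<lambda>k. {x. 1 / real (Suc k) \<le> v x}"
  \<comment> \<open>Cancelling \<open>v x\<close> in the quotient is legitimate only where
    \<open>v x\<close> is positive and finite.\<close>
  have le: "ennreal (t * v x) < maximal f x" if "x \<in> ?E" "0 < v x" for x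
  proof (rule ccontr)
    assume "\<not> ?thesis"
    then have "maximal f x / ennreal (v x) \<le> ennreal t * ennreal (v x) / ennreal (v x)"
      using t by (intro divide_right_mono_ennreal) (auto simp: ennreal_mult')
    also have "\<dots> = ennreal t" using that(2) by (simp add: ennreal_mult_divide_eq)
    finally show False using that(1) by simp
  qed
  have "(\<integral>\<^sup>+x. ennreal (v x) * indicator ?E x \<partial>lebesgue) \<le> ennreal (1 / t) * ?B"
  proof (rule nn_integral_le_exhaustion[of ?A])
    show "incseq ?A"
    proof (rule incseq_SucI, rule subsetI)
      fix k x assume "x \<in> ?A k"
      moreover have "1 / real (Suc (Suc k)) \<le> 1 / real (Suc k)" by (intro frac_le) auto
      ultimately show "x \<in> ?A (Suc k)" by (metis (mono_tags) mem_Collect_eq order_trans)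
    qed
    show "?A k \<in> sets lebesgue" for k
    proof -
      have "{x \<in> space lebesgue. 1 / real (Suc k) \<le> v x} \<in> sets lebesgue" by measurable
      then show ?thesis by simp
    qed
    show "{x. ennreal (v x) * indicator ?E x \<noteq> 0} \<subseteq> (\<Union>k. ?A k)"
    proof
      fix x assume "x \<in> {x. ennreal (v x) * indicator ?E x \<noteq> 0}"
      then have "0 < v x" by (auto simp: ennreal_eq_0_iff not_le)
      then obtain k where "inverse (real (Suc k)) < v x" using reals_Archimedean by blast
      then show "x \<in> (\<Union>k. ?A k)" by (auto simp: inverse_eq_divide intro!: less_imp_le)
    qed
    fix k
    let ?S = "{x. 1 / real (Suc k) \<le> v x \<and> ennreal (t * v x) < maximal f x}"
    have "x \<in> ?S" if "x \<in> ?E" "x \<in> ?A k" for x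
    proof -
      have "0 < v x" using that(2) by (auto intro: less_le_trans[rotated])
      then show ?thesis using that le[of x] by simp
    qed
    then have "(\<integral>\<^sup>+x\<in>?A k. ennreal (v x) * indicator ?E x \<partial>lebesgue)
        \<le> (\<integral>\<^sup>+x. ennreal (v x) * indicator ?S x \<partial>lebesgue)"
      by (intro nn_integral_mono) (auto simp: indicator_def)
    also have "\<dots> = ennreal (1 / t) * (ennreal t * (\<integral>\<^sup>+x\<in>?S. ennreal (v x) \<partial>lebesgue))"
      using t by (simp add: mult.assoc[symmetric] ennreal_mult[symmetric])
    also have "\<dots> \<le> ennreal (1 / t) * ?B"
      using weak_type_truncated[OF v f t, of "1 / real (Suc k)"] by (intro mult_left_mono) auto
    finally show "(\<integral>\<^sup>+x\<in>?A k. ennreal (v x) * indicator ?E x \<partial>lebesgue) \<le> ennreal (1 / t) * ?B" .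
  qed
  then have "ennreal t * (\<integral>\<^sup>+x\<in>?E. ennreal (v x) \<partial>lebesgue) \<le> ennreal t * (ennreal (1 / t) * ?B)"
    by (rule mult_left_mono) simp
  also have "\<dots> = ?B"
    using t by (simp add: mult.assoc[symmetric] ennreal_mult[symmetric])
  finally show "ennreal t * (\<integral>\<^sup>+x\<in>?E. ennreal (v x) \<partial>lebesgue) \<le> ?B" .
qed

section \<open>The logarithmic weight and its \<open>A1\<close> constant\<close>

lemma ennreal_inverse_antimono:
  fixes x y :: ennreal
  shows "x \<le> y \<Longrightarrow> inverse y \<le> inverse x"
  including ennreal.lifting
  by transfer (rule ereal_inverse_antimono)

text \<open>A lower bound for \<open>v\<close> at every point of \<open>Q\<close> is a lower bound
  for its essential infimum, so the usual pointwise form of the condition controls the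
  quotient.\<close>

lemma A1_const_leI:
  fixes v :: "real^'n \<Rightarrow> real"
  assumes c: "0 < c"
    and le: "\<And>Q y. Q \<in> cubes \<Longrightarrow> y \<in> Q \<Longrightarrow> average Q (\<lambda>x. ennreal (v x)) \<le> ennreal c * ennreal (v y)"
  shows "A1_const v \<le> ennreal c"
  unfolding A1_const_def
proof (rule SUP_least)
  fix Q :: "(real^'n) set" assume Q: "Q \<in> cubes"
  let ?m = "average Q (\<lambda>x. ennreal (v x))" and ?e = "ess_inf_on Q (\<lambda>x. ennreal (v x))"
  have "Q \<noteq> {}" using emeasure_cubes(1)[OF Q] by auto
  then obtain y where "y \<in> Q" by blast
  from le[OF Q this] have fin: "?m < top" by (auto simp: less_top[symmetric] top_unique ennreal_mult_eq_top_iff)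
  have "?m / ennreal c \<le> ennreal (v y)" if "y \<in> Q" for y
    using le[OF Q that] c by (intro divide_le_posI_ennreal) auto
  then have "?m / ennreal c \<le> ?e"
    unfolding ess_inf_on_def by (intro Sup_upper) auto
  then have "inverse ?e \<le> inverse (?m / ennreal c)"
    by (rule ennreal_inverse_antimono)
  then have "?m * inverse ?e \<le> ?m * inverse (?m / ennreal c)"
    by (rule mult_left_mono) simp
  \<comment> \<open>For positive finite \<open>?m\<close> the product is exactly \<open>c\<close>;
    for \<open>?m = 0\<close> it is \<open>0 * \<infinity> = 0\<close>.\<close>
  also have "\<dots> \<le> ennreal c"
  proof (cases "?m = 0")
    case False
    then obtain r where r: "0 < r" "?m = ennreal r" using fin by (cases ?m) auto
    then show ?thesis
      using c by (simp add: divide_ennreal inverse_ennreal ennreal_mult[symmetric])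
  qed simp
  finally show "?m * inverse ?e \<le> ennreal c" .
qed

text \<open>These are the nested cubes \<open>C\<^sub>k\<close> about the origin, with side
  \<open>2 * 2^-k\<close>, not the cells of a dyadic grid.\<close>

definition dyadic_cube :: "nat \<Rightarrow> (real^'n) set" where
  "dyadic_cube k = cbox (\<chi> i. - ((1/2) ^ k)) (\<chi> i. (1/2) ^ k)"

lemma mem_dyadic_cube: "x \<in> dyadic_cube k \<longleftrightarrow> (\<forall>i. \<bar>x $ i\<bar> \<le> (1/2) ^ k)"
  by (auto simp: dyadic_cube_def mem_box_cart abs_le_iff minus_le_iff)

lemma dyadic_cube_antimono: "j \<le> k \<Longrightarrow> (dyadic_cube k :: (real^'n) set) \<subseteq> dyadic_cube j"
proof
  fix x :: "real^'n"
  assume "j \<le> k" "x \<in> dyadic_cube k"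
  moreover from this have "(1/2 :: real) ^ k \<le> (1/2) ^ j" by (intro power_decreasing) auto
  ultimately show "x \<in> dyadic_cube j" by (auto simp: mem_dyadic_cube intro: order_trans)
qed

lemma dyadic_cube_eq: "dyadic_cube k = cbox (\<chi> i. - ((1/2) ^ k)) (\<chi> i. (\<chi> i. - ((1/2) ^ k)) $ i + 2 * (1/2) ^ k)"
  by (simp add: dyadic_cube_def)

lemma dyadic_cube_in_cubes: "dyadic_cube k \<in> cubes"
  unfolding cubes_def
  by (intro CollectI exI[of _ "\<chi> i. - ((1/2) ^ k)"] exI[of _ "2 * (1/2) ^ k"] conjI dyadic_cube_eq) simp

lemma sets_dyadic_cube [measurable]: "dyadic_cube k \<in> sets lebesgue"
  by (rule sets_cubes[OF dyadic_cube_in_cubes])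

text \<open>With \<open>q = 2^n\<close> the value is \<open>q / q^k\<close>: a layer of height
  \<open>q^k\<close> on \<open>C\<^sub>k\<close> has mass \<open>q\<close> for every
  \<open>k\<close>.\<close>

lemma emeasure_dyadic_cube:
  "emeasure lebesgue (dyadic_cube k :: (real^'n) set) = ennreal (2 ^ CARD('n) / (2 ^ CARD('n)) ^ k)"
proof -
  have "emeasure lebesgue (dyadic_cube k :: (real^'n) set) = ennreal ((2 * (1/2) ^ k) ^ CARD('n))"
    unfolding dyadic_cube_eq by (rule emeasure_cube) simp
  also have "(2 * (1/2) ^ k) ^ CARD('n) = (2 :: real) ^ CARD('n) / (2 ^ CARD('n)) ^ k"
    by (simp add: power_mult_distrib power_divide power_mult[symmetric] mult.commute)
  finally show ?thesis .
qed

text \<open>Comparable to \<open>max 1 (min (|x|\<^sup>-\<^sup>n) (2\<^sup>n\<^sup>N))\<close>, with a constant depending only on the dimension.\<close>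

definition log_weight :: "nat \<Rightarrow> real^'n \<Rightarrow> real" where
  "log_weight N x = 1 + (\<Sum>k\<le>N. (2 ^ CARD('n)) ^ k * indicator (dyadic_cube k) x)"

lemma log_weight_ge_1: "1 \<le> log_weight N x"
  by (simp add: log_weight_def sum_nonneg)

lemma log_weight_ge:
  fixes x :: "real^'n"
  assumes "k \<le> N" "x \<in> dyadic_cube k"
  shows "(2 ^ CARD('n)) ^ k \<le> log_weight N x"
proof -
  have "(2 ^ CARD('n)) ^ k * indicator (dyadic_cube k) x
      \<le> (\<Sum>k\<le>N. (2 ^ CARD('n)) ^ k * indicator (dyadic_cube k) x :: real)"
    using assms(1) by (intro member_le_sum) auto
  then show ?thesis using assms(2) by (simp add: log_weight_def)
qed

lemma ennreal_log_weight:
  fixes x :: "real^'n"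
  shows "ennreal (log_weight N x)
    = 1 + (\<Sum>k\<le>N. ennreal ((2 ^ CARD('n)) ^ k) * indicator (dyadic_cube k) x)"
proof -
  have "ennreal (log_weight N x) = 1 + ennreal (\<Sum>k\<le>N. (2 ^ CARD('n)) ^ k * indicator (dyadic_cube k) x)"
    by (simp add: log_weight_def sum_nonneg)
  also have "ennreal (\<Sum>k\<le>N. (2 ^ CARD('n)) ^ k * indicator (dyadic_cube k) x)
    = (\<Sum>k\<le>N. ennreal ((2 ^ CARD('n)) ^ k) * indicator (dyadic_cube k) x)"
    by (subst sum_ennreal[symmetric]) (auto intro!: sum.cong simp: indicator_def)
  finally show ?thesis .
qed

lemma nn_integral_log_weight:
  fixes A :: "(real^'n) set"
  assumes [measurable]: "A \<in> sets lebesgue"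
  shows "(\<integral>\<^sup>+x\<in>A. ennreal (log_weight N x) \<partial>lebesgue)
    = emeasure lebesgue A + (\<Sum>k\<le>N. ennreal ((2 ^ CARD('n)) ^ k) * emeasure lebesgue (dyadic_cube k \<inter> A))"
proof -
  have "(\<integral>\<^sup>+x\<in>A. ennreal (log_weight N x) \<partial>lebesgue) = (\<integral>\<^sup>+x. indicator A x
      + (\<Sum>k\<le>N. ennreal ((2 ^ CARD('n)) ^ k) * indicator (dyadic_cube k \<inter> A) x) \<partial>lebesgue)"
    by (intro nn_integral_cong)
      (auto simp: ennreal_log_weight indicator_def intro!: sum.cong)
  also have "\<dots> = (\<integral>\<^sup>+x. indicator A x \<partial>lebesgue)
      + (\<integral>\<^sup>+x. (\<Sum>k\<le>N. ennreal ((2 ^ CARD('n)) ^ k) * indicator (dyadic_cube k \<inter> A) x) \<partial>lebesgue)"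
    by (rule nn_integral_add; measurable)
  also have "(\<integral>\<^sup>+x. (\<Sum>k\<le>N. ennreal ((2 ^ CARD('n)) ^ k) * indicator (dyadic_cube k \<inter> A) x) \<partial>lebesgue)
      = (\<Sum>k\<le>N. \<integral>\<^sup>+x. ennreal ((2 ^ CARD('n)) ^ k) * indicator (dyadic_cube k \<inter> A) x \<partial>lebesgue)"
    by (rule nn_integral_sum) auto
  also have "\<dots> = (\<Sum>k\<le>N. ennreal ((2 ^ CARD('n)) ^ k) * emeasure lebesgue (dyadic_cube k \<inter> A))"
    by (intro sum.cong refl nn_integral_cmult_indicator) auto
  also have "(\<integral>\<^sup>+x. indicator A x \<partial>lebesgue) = emeasure lebesgue A"
    by (rule nn_integral_indicator) simp
  finally show ?thesis .
qed

lemma weight_log_weight: "weight (log_weight N :: real^'n \<Rightarrow> real)"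
  unfolding weight_def
proof (intro conjI allI impI)
  show "0 \<le> log_weight N x" for x :: "real^'n"
    using log_weight_ge_1[of N x] by simp
  fix K :: "(real^'n) set" assume K: "compact K"
  have [measurable]: "K \<in> sets lebesgue" and "emeasure lebesgue K < \<infinity>"
    using lmeasurable_compact[OF K] by (auto simp: fmeasurable_def)
  moreover from this have "emeasure lebesgue (dyadic_cube k \<inter> K) < \<infinity>" for k
    by (intro le_less_trans[OF emeasure_mono[of "dyadic_cube k \<inter> K" K lebesgue]]) auto
  ultimately have "integrable lebesgue (\<lambda>x. indicator K x
      + (\<Sum>k\<le>N. (2 ^ CARD('n)) ^ k * indicator (dyadic_cube k \<inter> K) x) :: real)"
    by (intro Bochner_Integration.integrable_add Bochner_Integration.integrable_sum
        integrable_mult_right integrable_real_indicator) auto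
  also have "(\<lambda>x. indicator K x
      + (\<Sum>k\<le>N. (2 ^ CARD('n)) ^ k * indicator (dyadic_cube k \<inter> K) x) :: real)
      = (\<lambda>x. indicator K x *\<^sub>R log_weight N x)"
    by (auto simp: log_weight_def indicator_def intro!: sum.cong)
  finally show "log_weight N absolutely_integrable_on K"
    by (simp add: set_integrable_def)
qed

text \<open>The bound for a single layer is free of \<open>N\<close>. Unless the layer misses
  \<open>Q\<close>, either its height is at most \<open>2^n\<close> times the weight at
  \<open>y\<close>, or \<open>Q\<close> stretches from \<open>y\<close> to a much smaller
  \<open>C\<^sub>k\<close> and is large enough to absorb the entire mass of the layer.\<close>

lemma log_weight_average_term:
  fixes Q :: "(real^'n) set"
  assumes Q: "Q \<in> cubes" and y: "y \<in> Q" and k: "k \<le> N"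
  shows "ennreal ((2 ^ CARD('n)) ^ k) * emeasure lebesgue (dyadic_cube k \<inter> Q)
    \<le> ennreal (8 ^ CARD('n) * log_weight N y) * emeasure lebesgue Q"
proof -
  let ?q = "2 ^ CARD('n) :: real"
  have q: "1 \<le> ?q" by simp
  have q3: "8 ^ CARD('n) = ?q * ?q * ?q"
    by (simp add: power_mult_distrib[symmetric])
  have v1: "1 \<le> log_weight N y" by (rule log_weight_ge_1)
  \<comment> \<open>Only the trivial bound \<open>|C\<^sub>k \<inter> Q| \<le> |Q|\<close> is used,
    with two factors \<open>q\<close> to spare.\<close>
  have small: ?thesis if "?q ^ k \<le> ?q * log_weight N y"
  proof (rule mult_mono)
    have "?q * log_weight N y \<le> ?q * ?q * ?q * log_weight N y"
      using q v1 by (intro mult_right_mono) (auto simp: mult.assoc intro!: mult_ge1_I)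
    then show "ennreal (?q ^ k) \<le> ennreal (8 ^ CARD('n) * log_weight N y)"
      unfolding q3 by (intro ennreal_leI order_trans[OF that])
    show "emeasure lebesgue (dyadic_cube k \<inter> Q) \<le> emeasure lebesgue Q"
      using sets_cubes[OF Q] by (intro emeasure_mono) auto
  qed auto
  show ?thesis
  proof (cases "y \<in> dyadic_cube k \<or> dyadic_cube k \<inter> Q = {}")
    case True
    then show ?thesis
    proof
      assume "y \<in> dyadic_cube k"
      then have "?q ^ k \<le> log_weight N y" by (rule log_weight_ge[OF k])
      also have "\<dots> \<le> ?q * log_weight N y"
        using mult_right_mono[OF q, of "log_weight N y"] v1 by simp
      finally show ?thesis by (rule small)
    qed simp
  next
    case False
    \<comment> \<open>\<open>y\<close> has sup norm about \<open>2\<^sup>-\<^sup>m\<close>, and \<open>Q\<close> joins it to the much smaller \<open>C\<^sub>k\<close>, so \<open>|Q|\<close> is at least about \<open>2\<^sup>-\<^sup>n\<^sup>m\<close>\<close>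
    define m where "m = (LEAST m. y \<notin> dyadic_cube m)"
    have yk: "y \<notin> dyadic_cube k" using False by blast
    have ym: "y \<notin> dyadic_cube m" unfolding m_def by (rule LeastI[where P = "\<lambda>m. y \<notin> dyadic_cube m", OF yk])
    have mk: "m \<le> k" unfolding m_def by (rule Least_le[where P = "\<lambda>m. y \<notin> dyadic_cube m", OF yk])
    \<comment> \<open>For positive \<open>m\<close>, minimality puts \<open>y\<close> in the
      preceding cube, whose layer is smaller by the factor \<open>q\<close>.\<close>
    have vm: "?q ^ m \<le> ?q * log_weight N y"
    proof (cases m)
      case 0
      then show ?thesis using mult_mono[OF q v1] by simp
    next
      case (Suc j)
      then have "y \<in> dyadic_cube j" using not_less_Least[of j "\<lambda>m. y \<notin> dyadic_cube m"] by (simp add: m_def)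
      then have "?q ^ j \<le> log_weight N y" using Suc mk k by (intro log_weight_ge) auto
      then show ?thesis using Suc by simp
    qed
    show ?thesis
    proof (cases "m = k")
      case True
      \<comment> \<open>At adjacent scales \<open>y\<close> may lie close to
        \<open>C\<^sub>k\<close>, so no lower bound on \<open>Q\<close> is available; the height
        comparison \<open>vm\<close> suffices.\<close>
      then show ?thesis using vm small by simp
    next
      case mk': False
      from False obtain z where z: "z \<in> dyadic_cube k" "z \<in> Q" by auto
      obtain i where i: "(1/2) ^ m < \<bar>y $ i\<bar>" using ym by (auto simp: mem_dyadic_cube not_le)
      obtain a l where l: "0 < l" "Q = cbox a (\<chi> i. a $ i + l)" using Q by (rule cubesE)
      \<comment> \<open>Since \<open>m < k\<close>, coordinate \<open>i\<close> of \<open>z\<close>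
        is at most half of \<open>2^-m\<close>, while that of \<open>y\<close> exceeds
        \<open>2^-m\<close>. The side of \<open>Q\<close> is therefore at least
        \<open>2^-m / 2\<close>.\<close>
      have "\<bar>z $ i\<bar> \<le> (1/2) ^ k" using z by (simp add: mem_dyadic_cube)
      also have "\<dots> \<le> (1/2) ^ Suc m" using mk mk' by (intro power_decreasing) auto
      finally have "(1/2) ^ m / 2 \<le> \<bar>y $ i - z $ i\<bar>"
        using i abs_triangle_ineq2[of "y $ i" "z $ i"] by simp
      moreover have "\<bar>y $ i - z $ i\<bar> \<le> l"
      proof -
        have "a $ i \<le> y $ i \<and> y $ i \<le> a $ i + l" "a $ i \<le> z $ i \<and> z $ i \<le> a $ i + l"
          using y z(2) by (simp_all add: l(2) mem_cube)
        then show ?thesis by arith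
      qed
      ultimately have "((1/2) ^ m / 2) ^ CARD('n) \<le> l ^ CARD('n)"
        by (intro power_mono) auto
      also have "((1/2) ^ m / 2) ^ CARD('n) = 1 / (?q ^ m * ?q)"
        by (simp add: power_mult_distrib power_divide power_mult[symmetric] mult.commute)
      finally have "1 \<le> ?q ^ m * ?q * l ^ CARD('n)"
        by (simp add: field_simps)
      also have "\<dots> \<le> ?q * log_weight N y * ?q * l ^ CARD('n)"
        using vm l(1) by (intro mult_right_mono) auto
      \<comment> \<open>The three factors \<open>q\<close> making up \<open>8^n\<close> come from
        \<open>vm\<close>, from the halved distance, and from the mass \<open>q\<close> of the
        layer.\<close>
      finally have "?q * 1 \<le> ?q * (?q * log_weight N y * ?q * l ^ CARD('n))"
        by (intro mult_left_mono) auto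
      then have le: "?q \<le> 8 ^ CARD('n) * log_weight N y * l ^ CARD('n)"
        unfolding q3 by (simp only: mult_ac mult_1_left)
      have "ennreal (?q ^ k) * emeasure lebesgue (dyadic_cube k \<inter> Q)
          \<le> ennreal (?q ^ k) * emeasure lebesgue (dyadic_cube k :: (real^'n) set)"
        by (intro mult_left_mono emeasure_mono) auto
      also have "\<dots> = ennreal ?q"
        unfolding emeasure_dyadic_cube by (subst ennreal_mult[symmetric]) auto
      also have "\<dots> \<le> ennreal (8 ^ CARD('n) * log_weight N y) * emeasure lebesgue Q"
        using le l v1 by (simp add: emeasure_cube ennreal_mult[symmetric] ennreal_leI del: emeasure_completion)
      finally show ?thesis .
    qed
  qed
qed

text \<open>There are \<open>N + 1\<close> layers, each bounded without \<open>N\<close>; the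
  summand 1 of the weight is absorbed by the factor 2.\<close>

lemma A1_const_log_weight_le:
  "A1_const (log_weight N :: real^'n \<Rightarrow> real) \<le> ennreal (2 * 8 ^ CARD('n) * (real N + 1))"
proof (rule A1_const_leI)
  show "0 < 2 * 8 ^ CARD('n) * (real N + 1)" by (intro mult_pos_pos) auto
  fix Q :: "(real^'n) set" and y assume Q: "Q \<in> cubes" and y: "y \<in> Q"
  let ?w = "8 ^ CARD('n) * log_weight N y" and ?m = "emeasure lebesgue Q"
  have v1: "1 \<le> log_weight N y" by (rule log_weight_ge_1)
  have w1: "1 \<le> ?w" using v1 by (intro mult_ge1_I) auto
  have "(\<integral>\<^sup>+x\<in>Q. ennreal (log_weight N x) \<partial>lebesgue)
      \<le> ?m + (\<Sum>k\<le>N. ennreal ?w * ?m)"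
    unfolding nn_integral_log_weight[OF sets_cubes[OF Q]]
    by (intro add_left_mono sum_mono log_weight_average_term Q y) auto
  also have "\<dots> = ennreal (1 + (real N + 1) * ?w) * ?m"
    using w1 by (simp add: ennreal_mult ennreal_of_nat_eq_real_of_nat distrib_right mult.assoc
        del: emeasure_completion)
  also have "\<dots> \<le> ennreal (2 * 8 ^ CARD('n) * (real N + 1) * log_weight N y) * ?m"
  proof (intro mult_right_mono ennreal_leI)
    have "1 * 1 \<le> (real N + 1) * ?w" using w1 by (intro mult_mono) auto
    then show "1 + (real N + 1) * ?w \<le> 2 * 8 ^ CARD('n) * (real N + 1) * log_weight N y"
      by (simp add: algebra_simps)
  qed simp
  finally show "average Q (\<lambda>x. ennreal (log_weight N x))
      \<le> ennreal (2 * 8 ^ CARD('n) * (real N + 1)) * ennreal (log_weight N y)"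
    unfolding average_def using emeasure_cubes(1)[OF Q] v1
    by (intro divide_le_posI_ennreal) (simp_all add: ennreal_mult[symmetric] mult_ac del: emeasure_completion)
qed

lemma log_weight_in_A1: "(log_weight N :: real^'n \<Rightarrow> real) \<in> A1"
  using weight_log_weight A1_const_log_weight_le[of N, where 'n='n]
  by (auto simp: A1_def intro: le_less_trans)

section \<open>Lower bound for the weak norm of the test pair\<close>

lemma sum_power_le:
  fixes q :: real
  assumes "2 \<le> q"
  shows "(\<Sum>i\<le>j. q ^ i) \<le> 2 * q ^ j"
proof (induction j)
  case (Suc j)
  have "2 * q ^ j \<le> q * q ^ j" using assms by (intro mult_right_mono) auto
  then show ?case using Suc by simp
qed simp

text \<open>The smallest \<open>C\<^sub>j\<close> with \<open>j \<le> N\<close> containing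
  \<open>y\<close> serves as the competing cube. Its average of the indicator is
  \<open>q^j / q^N\<close>, and the layers present at \<open>y\<close> form a geometric sum giving a
  weight of at most \<open>3 * q^j\<close>.\<close>

lemma maximal_dyadic_cube_ge:
  fixes y :: "real^'n"
  assumes y: "y \<in> dyadic_cube 0"
  shows "ennreal (log_weight N y / (3 * (2 ^ CARD('n)) ^ N)) \<le> maximal (indicator (dyadic_cube N)) y"
proof -
  let ?q = "2 ^ CARD('n) :: real"
  have q: "2 \<le> ?q" using power_increasing[of 1 "CARD('n)" "2::real"] by simp
  \<comment> \<open>The cap \<open>j \<le> N\<close> makes the maximum exist even at the origin,
    which lies in all the cubes.\<close>
  define j where "j = (GREATEST j. j \<le> N \<and> y \<in> dyadic_cube j)"
  have ex: "0 \<le> N \<and> y \<in> dyadic_cube 0" using y by simp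
  have j: "j \<le> N" "y \<in> dyadic_cube j"
    unfolding j_def using GreatestI_nat[where P="\<lambda>j. j \<le> N \<and> y \<in> dyadic_cube j" and b=N, OF ex] by auto
  have jmax: "i \<le> j" if "i \<le> N" "y \<in> dyadic_cube i" for i
    unfolding j_def using Greatest_le_nat[where P="\<lambda>j. j \<le> N \<and> y \<in> dyadic_cube j" and b=N] that by auto
  have "(\<Sum>k\<le>N. ?q ^ k * indicator (dyadic_cube k) y) \<le> (\<Sum>k\<le>N. if k \<le> j then ?q ^ k else 0)"
    using jmax by (intro sum_mono) (auto simp: indicator_def)
  also have "\<dots> = (\<Sum>k\<le>j. ?q ^ k)"
    using j(1) by (intro sum.mono_neutral_cong_right) auto
  also have "\<dots> \<le> 2 * ?q ^ j" using q by (rule sum_power_le)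
  finally have "log_weight N y \<le> 1 + 2 * ?q ^ j" by (simp add: log_weight_def)
  also have "\<dots> \<le> 3 * ?q ^ j" using one_le_power[of ?q j] q by simp
  finally have "log_weight N y / (3 * ?q ^ N) \<le> 3 * ?q ^ j / (3 * ?q ^ N)"
    by (rule divide_right_mono) simp
  then have "ennreal (log_weight N y / (3 * ?q ^ N)) \<le> ennreal (?q ^ j / ?q ^ N)"
    by (intro ennreal_leI) simp
  also have "\<dots> = emeasure lebesgue (dyadic_cube N :: (real^'n) set) / emeasure lebesgue (dyadic_cube j :: (real^'n) set)"
    unfolding emeasure_dyadic_cube by (subst divide_ennreal) (auto simp: field_simps)
  also have "\<dots> = average (dyadic_cube j) (\<lambda>x. ennreal \<bar>indicator (dyadic_cube N) (x :: real^'n)\<bar>)"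
  proof -
    have "(\<integral>\<^sup>+x\<in>dyadic_cube j. ennreal \<bar>indicator (dyadic_cube N) (x :: real^'n)\<bar> \<partial>lebesgue)
        = (\<integral>\<^sup>+x. indicator (dyadic_cube N :: (real^'n) set) x \<partial>lebesgue)"
      using dyadic_cube_antimono[OF j(1)] by (intro nn_integral_cong) (auto simp: indicator_def)
    then show ?thesis by (simp add: average_def del: emeasure_completion)
  qed
  also have "\<dots> \<le> maximal (indicator (dyadic_cube N)) y"
    unfolding maximal_def using j(2) dyadic_cube_in_cubes by (intro SUP_upper) auto
  finally show ?thesis .
qed

lemma L1_norm_dyadic_cube:
  "L1_norm (indicator (dyadic_cube N) :: real^'n \<Rightarrow> real) = ennreal (2 ^ CARD('n) / (2 ^ CARD('n)) ^ N)"
proof -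
  have "L1_norm (indicator (dyadic_cube N) :: real^'n \<Rightarrow> real)
      = (\<integral>\<^sup>+x. indicator (dyadic_cube N :: (real^'n) set) x \<partial>lebesgue)"
    unfolding L1_norm_def by (intro nn_integral_cong) (auto simp: indicator_def)
  then show ?thesis by (simp add: emeasure_dyadic_cube del: emeasure_completion)
qed

text \<open>One level suffices: its superlevel set contains \<open>C\<^sub>0\<close>, where every
  layer contributes its full mass \<open>q\<close>.\<close>

lemma weak_L1_norm_log_weight_ge:
  "ennreal ((real N + 1) / 4) * L1_norm (indicator (dyadic_cube N) :: real^'n \<Rightarrow> real)
    \<le> weak_L1_norm (log_weight N) (\<lambda>x :: real^'n. maximal (indicator (dyadic_cube N)) x / ennreal (log_weight N x))"
proof -
  let ?q = "2 ^ CARD('n) :: real"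
  let ?F = "\<lambda>x :: real^'n. maximal (indicator (dyadic_cube N)) x / ennreal (log_weight N x)"
  \<comment> \<open>The 4 in place of 3 turns the lower bound for the quotient into the strict
    inequality of the superlevel set.\<close>
  define t where "t = 1 / (4 * ?q ^ N)"
  have t: "0 < t" by (simp add: t_def)
  have "ennreal t < ?F x" if "x \<in> dyadic_cube 0" for x
  proof -
    have v1: "1 \<le> log_weight N x" by (rule log_weight_ge_1)
    have "ennreal t < ennreal (1 / (3 * ?q ^ N))"
      unfolding t_def by (intro ennreal_lessI divide_strict_left_mono) auto
    also have "\<dots> = ennreal (log_weight N x / (3 * ?q ^ N)) / ennreal (log_weight N x)"
      using v1 by (subst divide_ennreal) auto
    also have "\<dots> \<le> ?F x"
      by (intro divide_right_mono_ennreal maximal_dyadic_cube_ge that)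
    finally show ?thesis .
  qed
  then have sub: "dyadic_cube 0 \<subseteq> {x. ennreal t < ?F x}" by auto
  have "(\<Sum>k\<le>N. ennreal (?q ^ k) * emeasure lebesgue (dyadic_cube k \<inter> dyadic_cube 0 :: (real^'n) set))
      = (\<Sum>k\<le>N. ennreal ?q)"
  proof (rule sum.cong)
    fix k
    have "dyadic_cube k \<inter> dyadic_cube 0 = (dyadic_cube k :: (real^'n) set)"
      using dyadic_cube_antimono[of 0 k] by auto
    then show "ennreal (?q ^ k) * emeasure lebesgue (dyadic_cube k \<inter> dyadic_cube 0 :: (real^'n) set) = ennreal ?q"
      unfolding emeasure_dyadic_cube by (simp add: emeasure_dyadic_cube ennreal_mult[symmetric] del: emeasure_completion)
  qed simp
  also have "\<dots> = ennreal ((real N + 1) * ?q)"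
    by (simp add: ennreal_mult ennreal_of_nat_eq_real_of_nat add.commute)
  \<comment> \<open>The contribution of the summand 1 of the weight is dropped.\<close>
  finally have "ennreal ((real N + 1) * ?q) \<le> (\<integral>\<^sup>+x\<in>dyadic_cube 0. ennreal (log_weight N (x :: real^'n)) \<partial>lebesgue)"
    by (simp add: nn_integral_log_weight del: emeasure_completion)
  also have "\<dots> \<le> (\<integral>\<^sup>+x\<in>{x. ennreal t < ?F x}. ennreal (log_weight N x) \<partial>lebesgue)"
    using sub by (intro nn_integral_mono mult_left_mono) (auto simp: indicator_def)
  finally have le: "ennreal ((real N + 1) * ?q)
      \<le> (\<integral>\<^sup>+x\<in>{x. ennreal t < ?F x}. ennreal (log_weight N x) \<partial>lebesgue)" .
  have "ennreal ((real N + 1) / 4) * L1_norm (indicator (dyadic_cube N) :: real^'n \<Rightarrow> real)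
      = ennreal t * ennreal ((real N + 1) * ?q)"
    unfolding L1_norm_dyadic_cube t_def by (simp add: ennreal_mult[symmetric] mult_ac)
  also have "\<dots> \<le> ennreal t * (\<integral>\<^sup>+x\<in>{x. ennreal t < ?F x}. ennreal (log_weight N x) \<partial>lebesgue)"
    using le by (rule mult_left_mono) simp
  also have "\<dots> \<le> weak_L1_norm (log_weight N) ?F"
    unfolding weak_L1_norm_def using t by (intro SUP_upper) auto
  finally show ?thesis .
qed

text \<open>Sharpness is a reverse inequality whose \<open>c\<close> is fixed before
  \<open>K\<close>, for weights with arbitrarily large constant. As \<open>L1_norm f\<close> is
  positive and finite there, no bound of sublinear growth in \<open>A1_const v\<close> can
  hold.\<close>

theorem theorem1p8:
  shows "(\<exists>c>0::real. \<forall>(v :: real^'n \<Rightarrow> real) \<in> A1. \<forall>f :: real^'n \<Rightarrow> real. integrable lebesgue f \<longrightarrow>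
            weak_L1_norm v (\<lambda>x. maximal f x / ennreal (v x)) \<le> ennreal c * A1_const v * L1_norm f)
       \<and> (\<exists>c>0::real. \<forall>K::real. \<exists>(v :: real^'n \<Rightarrow> real) \<in> A1. \<exists>f :: real^'n \<Rightarrow> real.
            ennreal K \<le> A1_const v \<and> integrable lebesgue f \<and> 0 < L1_norm f \<and>
            ennreal c * A1_const v * L1_norm f \<le> weak_L1_norm v (\<lambda>x. maximal f x / ennreal (v x)))"
proof
  define C where "C = (25 * real CARD('n)) ^ CARD('n)"
  have C: "0 < C" by (simp add: C_def)
  show "\<exists>c>0::real. \<forall>(v :: real^'n \<Rightarrow> real) \<in> A1. \<forall>f :: real^'n \<Rightarrow> real. integrable lebesgue f \<longrightarrow>
      weak_L1_norm v (\<lambda>x. maximal f x / ennreal (v x)) \<le> ennreal c * A1_const v * L1_norm f"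
  proof (intro exI[of _ C] conjI ballI allI impI C)
    fix v f :: "real^'n \<Rightarrow> real"
    assume "v \<in> A1" "integrable lebesgue f"
    then show "weak_L1_norm v (\<lambda>x. maximal f x / ennreal (v x)) \<le> ennreal C * A1_const v * L1_norm f"
      unfolding C_def by (rule weak_type_A1)
  qed
  \<comment> \<open>Chosen so that \<open>?d\<close> times the upper bound
    \<open>2 * 8^n * (N + 1)\<close> for the \<open>A1\<close> constant equals
    \<open>(N + 1) / 4\<close>.\<close>
  let ?d = "1 / (8 * 8 ^ CARD('n)) :: real"
  show "\<exists>c>0::real. \<forall>K::real. \<exists>(v :: real^'n \<Rightarrow> real) \<in> A1. \<exists>f :: real^'n \<Rightarrow> real.
      ennreal K \<le> A1_const v \<and> integrable lebesgue f \<and> 0 < L1_norm f \<and>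
      ennreal c * A1_const v * L1_norm f \<le> weak_L1_norm v (\<lambda>x. maximal f x / ennreal (v x))"
  proof (intro exI[of _ ?d] conjI allI)
    show "0 < ?d" by simp
    fix K :: real
    obtain N :: nat where N: "4 * (C * K) \<le> real N"
      using real_arch_simple by blast
    let ?v = "log_weight N :: real^'n \<Rightarrow> real" and ?f = "indicator (dyadic_cube N) :: real^'n \<Rightarrow> real"
    let ?W = "weak_L1_norm ?v (\<lambda>x. maximal ?f x / ennreal (?v x))"
    have f: "integrable lebesgue ?f"
      using emeasure_cubes(2)[OF dyadic_cube_in_cubes, of N]
      by (intro integrable_real_indicator) auto
    define L :: real where "L = 2 ^ CARD('n) / (2 ^ CARD('n)) ^ N"
    have L: "0 < L" "L1_norm ?f = ennreal L"
      by (simp_all add: L_def L1_norm_dyadic_cube)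
    have lower: "ennreal ((real N + 1) / 4) * L1_norm ?f \<le> ?W"
      by (rule weak_L1_norm_log_weight_ge)
    have "A1_const ?v \<noteq> top"
      using A1_const_log_weight_le[of N, where 'n='n] by (auto simp: top_unique)
    then obtain A where A: "0 \<le> A" "A1_const ?v = ennreal A"
      by (cases "A1_const ?v") auto
    \<comment> \<open>The proved upper bound, read backwards, forces the \<open>A1\<close> constant
      to be at least \<open>(N + 1) / (4 * C)\<close>; the choice of \<open>N\<close> puts this
      above \<open>K\<close>.\<close>
    have "ennreal ((real N + 1) / 4) * L1_norm ?f \<le> ennreal C * A1_const ?v * L1_norm ?f"
      using lower weak_type_A1[OF log_weight_in_A1 f] unfolding C_def by (rule order_trans)
    then have "(real N + 1) / 4 * L \<le> C * A * L"
      using A L C by (simp add: ennreal_mult[symmetric])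
    then have "(real N + 1) / 4 \<le> C * A" using L(1) by (rule mult_right_le_imp_le)
    moreover have "C * K \<le> real N / 4" using N by simp
    moreover have "real N / 4 \<le> (real N + 1) / 4" by simp
    ultimately have "C * K \<le> C * A" by (blast intro: order_trans)
    then have "K \<le> A" using C by (rule mult_left_le_imp_le)
    then have K: "ennreal K \<le> A1_const ?v" unfolding A(2) by (rule ennreal_leI)
    have "ennreal ?d * A1_const ?v \<le> ennreal ?d * ennreal (2 * 8 ^ CARD('n) * (real N + 1))"
      by (rule mult_left_mono[OF A1_const_log_weight_le]) simp
    also have "\<dots> = ennreal (?d * (2 * 8 ^ CARD('n) * (real N + 1)))"
      by (rule ennreal_mult[symmetric]) simp_all
    also have "?d * (2 * 8 ^ CARD('n) * (real N + 1)) = (real N + 1) / 4"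
      by simp
    finally have "ennreal ?d * A1_const ?v * L1_norm ?f \<le> ennreal ((real N + 1) / 4) * L1_norm ?f"
      by (rule mult_right_mono) simp
    also note lower
    finally have "ennreal ?d * A1_const ?v * L1_norm ?f \<le> ?W" .
    moreover have "0 < L1_norm ?f" using L by simp
    ultimately have "ennreal K \<le> A1_const ?v \<and> integrable lebesgue ?f \<and> 0 < L1_norm ?f \<and>
        ennreal ?d * A1_const ?v * L1_norm ?f \<le> ?W"
      using K f by (intro conjI)
    then have "\<exists>f :: real^'n \<Rightarrow> real. ennreal K \<le> A1_const ?v \<and> integrable lebesgue f \<and> 0 < L1_norm f \<and>
        ennreal ?d * A1_const ?v * L1_norm f \<le> weak_L1_norm ?v (\<lambda>x. maximal f x / ennreal (?v x))"
      by (rule exI[of _ ?f])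
    then show "\<exists>v\<in>A1. \<exists>f :: real^'n \<Rightarrow> real. ennreal K \<le> A1_const v \<and> integrable lebesgue f \<and> 0 < L1_norm f \<and>
        ennreal ?d * A1_const v * L1_norm f \<le> weak_L1_norm v (\<lambda>x. maximal f x / ennreal (v x))"
      by (rule bexI[of _ ?v]) (rule log_weight_in_A1)
  qed
qed

end
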